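(* Let $N\ge 1$ and $n\ge 1$ be integers, let $\sigma_n$ be the $n$-simplex spanned by a geometrically independent set $\{\mathbf{a}_0,\ldots,\mathbf{a}_n\}$ in $\mathbb{R}^N$, and let $\mathbb{B}^n$ be the closed unit ball in $\mathbb{R}^n$. Then there is a homeomorphism of $\sigma_n$ with $\mathbb{B}^n$ that carries $\operatorname{Bd}(\sigma_n)$ onto the unit sphere $\mathbb{S}^{n-1}$.
   Context: Points $\mathbf{a}_0,\ldots,\mathbf{a}_n$ of $\mathbb{R}^N$ are geometrically independent if for all real scalars $t_i$, the equations $\sum_{i=0}^n t_i=0$ and $\sum_{i=0}^n t_i\mathbf{a}_i=\mathbf{0}$ imply $t_i=0$ for all $i$. The $n$-simplex spanned by such points is $\sigma_n=\{\sum_{i=0}^n t_i\mathbf{a}_i : t_i\ge 0,\ \sum_{i=0}^n t_i=1\}$, with the subspace topology from $\mathbb{R}^N$. Its boundary $\operatorname{Bd}(\sigma_n)$ is the union of its $(n-1)$-dimensional faces (the simplices spanned by the sets obtained by omitting one vertex $\mathbf{a}_i$), i.e. the set of points of $\sigma_n$ with at least one barycentric coordinate $t_i$ equal to $0$. $\mathbb{B}^n=\{\mathbf{x}\in\mathbb{R}^n:\|\mathbf{x}\|\le1\}$ and $\mathbb{S}^{n-1}=\{\mathbf{x}\in\mathbb{R}^n:\|\mathbf{x}\|=1\}$ with the Euclidean norm. *)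

theory Defs
  imports "HOL-Analysis.Analysis"
begin

definition geometrically_independent :: "'i set \<Rightarrow> ('i \<Rightarrow> 'a::real_vector) \<Rightarrow> bool" where
  "geometrically_independent I a \<longleftrightarrow>
     (\<forall>t :: 'i \<Rightarrow> real. (\<Sum>i\<in>I. t i) = 0 \<longrightarrow> (\<Sum>i\<in>I. t i *\<^sub>R a i) = 0 \<longrightarrow> (\<forall>i\<in>I. t i = 0))"

definition spanned_simplex :: "'i set \<Rightarrow> ('i \<Rightarrow> 'a::real_vector) \<Rightarrow> 'a set" where
  "spanned_simplex I a =
     {\<Sum>i\<in>I. t i *\<^sub>R a i | t :: 'i \<Rightarrow> real. (\<forall>i\<in>I. 0 \<le> t i) \<and> (\<Sum>i\<in>I. t i) = 1}"

definition simplex_Bd :: "'i set \<Rightarrow> ('i \<Rightarrow> 'a::real_vector) \<Rightarrow> 'a set" where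
  "simplex_Bd I a = (\<Union>j\<in>I. spanned_simplex (I - {j}) a)"

text \<open>
  The index set is always finite below. For finite families, the notions agree with
  \<^const>\<open>affine_dependent\<close> and \<^const>\<open>hull\<close> on the image set, and \<^const>\<open>simplex_Bd\<close> consists of the
  points having some barycentric coordinate equal to zero.
\<close>

lemma geometrically_independent_iff:
  assumes "finite I"
  shows "geometrically_independent I a \<longleftrightarrow> inj_on a I \<and> \<not> affine_dependent (a ` I)"
proof
  assume g: "geometrically_independent I a"
  have inj: "inj_on a I"
  proof (rule inj_onI, rule ccontr)
    fix i j assume ij: "i \<in> I" "j \<in> I" "a i = a j" "i \<noteq> j"
    define t :: "_ \<Rightarrow> real" where "t = (\<lambda>k. (if k = i then 1 else 0) - (if k = j then 1 else 0))"
    have "(\<Sum>k\<in>I. t k) = 0"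
      using ij assms by (simp add: t_def sum_subtractf)
    moreover have "(\<Sum>k\<in>I. t k *\<^sub>R a k) = 0"
    proof -
      have "(\<Sum>k\<in>I. t k *\<^sub>R a k) = (\<Sum>k\<in>I. (if k = i then a k else 0) - (if k = j then a k else 0))"
        by (rule sum.cong) (auto simp: t_def)
      then show ?thesis using ij assms by (simp add: sum_subtractf)
    qed
    ultimately have "t i = 0"
      using g ij(1) unfolding geometrically_independent_def by blast
    then show False using ij(4) by (simp add: t_def)
  qed
  moreover have "\<not> affine_dependent (a ` I)"
  proof
    assume "affine_dependent (a ` I)"
    then obtain u where u: "sum u (a ` I) = 0" "\<exists>v\<in>a ` I. u v \<noteq> 0" "(\<Sum>v\<in>a ` I. u v *\<^sub>R v) = 0"
      using assms by (auto simp: affine_dependent_explicit_finite)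
    then have "(\<Sum>i\<in>I. u (a i)) = 0" "(\<Sum>i\<in>I. u (a i) *\<^sub>R a i) = 0"
      using inj by (simp_all add: sum.reindex)
    with g have "\<forall>i\<in>I. u (a i) = 0"
      unfolding geometrically_independent_def by blast
    with u(2) show False by auto
  qed
  ultimately show "inj_on a I \<and> \<not> affine_dependent (a ` I)" ..
next
  assume r: "inj_on a I \<and> \<not> affine_dependent (a ` I)"
  show "geometrically_independent I a"
    unfolding geometrically_independent_def
  proof (intro allI impI ballI, rule ccontr)
    fix t :: "_ \<Rightarrow> real" and i
    assume t: "sum t I = 0" "(\<Sum>i\<in>I. t i *\<^sub>R a i) = 0" "i \<in> I" "t i \<noteq> 0"
    define u where "u = t \<circ> inv_into I a"
    have u: "u (a k) = t k" if "k \<in> I" for k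
      using r that by (simp add: u_def)
    have "sum u (a ` I) = 0" "(\<Sum>v\<in>a ` I. u v *\<^sub>R v) = 0"
      using r t u by (simp_all add: sum.reindex)
    moreover have "\<exists>v\<in>a ` I. u v \<noteq> 0" using t u by auto
    ultimately have "affine_dependent (a ` I)"
      using assms by (auto simp: affine_dependent_explicit_finite)
    with r show False by blast
  qed
qed

lemma spanned_simplex_eq_convex_hull:
  assumes "finite I" "inj_on a I"
  shows "spanned_simplex I a = convex hull (a ` I)"
proof (rule set_eqI, rule iffI)
  fix x assume "x \<in> spanned_simplex I a"
  then obtain t where t: "\<forall>i\<in>I. 0 \<le> t i" "sum t I = 1" "x = (\<Sum>i\<in>I. t i *\<^sub>R a i)"
    by (auto simp: spanned_simplex_def)
  show "x \<in> convex hull (a ` I)"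
    unfolding t(3) using assms t
    by (intro convex_sum) (auto simp: hull_inc)
next
  fix x assume "x \<in> convex hull (a ` I)"
  then obtain u where u: "\<forall>v\<in>a ` I. 0 \<le> u v" "sum u (a ` I) = 1" "(\<Sum>v\<in>a ` I. u v *\<^sub>R v) = x"
    using assms by (auto simp: convex_hull_finite)
  then show "x \<in> spanned_simplex I a"
    using assms unfolding spanned_simplex_def
    by (auto simp: sum.reindex intro!: exI[of _ "u \<circ> a"])
qed

lemma simplex_Bd_eq_zero_coordinate:
  assumes "finite I"
  shows "simplex_Bd I a =
     {\<Sum>i\<in>I. t i *\<^sub>R a i | t :: 'i \<Rightarrow> real.
        (\<forall>i\<in>I. 0 \<le> t i) \<and> (\<Sum>i\<in>I. t i) = 1 \<and> (\<exists>j\<in>I. t j = 0)}"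
proof (rule set_eqI, rule iffI)
  fix x assume "x \<in> simplex_Bd I a"
  then obtain j t where j: "j \<in> I" and t: "\<forall>i\<in>I - {j}. 0 \<le> t i" "sum t (I - {j}) = (1::real)"
      "x = (\<Sum>i\<in>I - {j}. t i *\<^sub>R a i)"
    by (auto simp: simplex_Bd_def spanned_simplex_def)
  have "x = (\<Sum>i\<in>I. (t(j := 0)) i *\<^sub>R a i)" "(\<Sum>i\<in>I. (t(j := 0)) i) = 1"
    unfolding sum.remove[OF assms j] using t by simp_all
  moreover have "\<forall>i\<in>I. 0 \<le> (t(j := 0)) i" "(t(j := 0)) j = 0" using t by auto
  ultimately show "x \<in> {\<Sum>i\<in>I. t i *\<^sub>R a i | t :: 'i \<Rightarrow> real.
        (\<forall>i\<in>I. 0 \<le> t i) \<and> (\<Sum>i\<in>I. t i) = 1 \<and> (\<exists>j\<in>I. t j = 0)}"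
    using j by blast
next
  fix x assume "x \<in> {\<Sum>i\<in>I. t i *\<^sub>R a i | t :: 'i \<Rightarrow> real.
        (\<forall>i\<in>I. 0 \<le> t i) \<and> (\<Sum>i\<in>I. t i) = 1 \<and> (\<exists>j\<in>I. t j = 0)}"
  then obtain t :: "'i \<Rightarrow> real" and j where t: "\<forall>i\<in>I. 0 \<le> t i" "sum t I = 1" "j \<in> I" "t j = 0"
      "x = (\<Sum>i\<in>I. t i *\<^sub>R a i)"
    by auto
  have "x = (\<Sum>i\<in>I - {j}. t i *\<^sub>R a i)" "sum t (I - {j}) = 1"
    using t sum.remove[OF assms t(3), of t] sum.remove[OF assms t(3), of "\<lambda>i. t i *\<^sub>R a i"]
    by simp_all
  then show "x \<in> simplex_Bd I a"
    using t unfolding simplex_Bd_def spanned_simplex_def by blast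
qed

end

theory Submission
  imports Defs
begin

text \<open>
  A simplex is a compact convex set of the same affine dimension as the ball, hence homeomorphic
  to it. That any such homeomorphism respects boundaries is invariance of domain: it maps the
  relative interior onto an open set, and so into the relative interior.
\<close>

lemma homeomorphism_image_rel_interior_subset:
  fixes S :: "'a::euclidean_space set" and T :: "'b::euclidean_space set"
  assumes h: "homeomorphism S T h k" and dim: "aff_dim T \<le> aff_dim S"
  shows "h ` rel_interior S \<subseteq> rel_interior T"
proof -
  have sub: "h ` rel_interior S \<subseteq> T"
    using homeomorphism_image1[OF h] rel_interior_subset[of S] by blast
  \<comment> \<open>The ambient space is the whole of \<open>affine hull T\<close>, not just
    \<open>T\<close>: invariance of domain between affine sets needs a target of dimension at most
    that of the source, which is \<open>dim\<close>.\<close>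
  have "openin (top_of_set (affine hull T)) (h ` rel_interior S)"
  proof (rule invariance_of_domain_affine_sets)
    show "openin (top_of_set (affine hull S)) (rel_interior S)"
      by (rule openin_rel_interior)
    show "continuous_on (rel_interior S) h"
      using homeomorphism_cont1[OF h] rel_interior_subset by (rule continuous_on_subset)
    show "inj_on h (rel_interior S)"
      by (rule inj_on_inverseI[where g = k])
        (use homeomorphism_apply1[OF h] rel_interior_subset in blast)
    show "h \<in> rel_interior S \<rightarrow> affine hull T"
      using sub hull_subset[of T affine] by blast
  qed (use dim in auto)
  \<comment> \<open>\<open>rel_interior T\<close> contains every subset of \<open>T\<close> that is
    open in \<open>affine hull T\<close>.\<close>
  then show ?thesis
    by (intro rel_interior_maximal sub)
qed

text \<open>With equal dimensions the inclusion applies to \<open>h\<close> and to its inverse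
  \<open>k\<close>; applying \<open>h\<close> to the second inclusion reverses the first.\<close>

lemma homeomorphism_image_rel_interior:
  fixes S :: "'a::euclidean_space set" and T :: "'b::euclidean_space set"
  assumes h: "homeomorphism S T h k" and dim: "aff_dim S = aff_dim T"
  shows "h ` rel_interior S = rel_interior T"
proof
  show "h ` rel_interior S \<subseteq> rel_interior T"
    using homeomorphism_image_rel_interior_subset[OF h] dim by simp
  have "k ` rel_interior T \<subseteq> rel_interior S"
    using homeomorphism_image_rel_interior_subset[OF homeomorphism_symD[OF h]] dim by simp
  moreover have "y = h (k y)" if "y \<in> rel_interior T" for y
    using homeomorphism_apply2[OF h] that rel_interior_subset by fastforce
  ultimately show "rel_interior T \<subseteq> h ` rel_interior S"
    by blast
qed

text \<open>For closed sets the relative frontier is the set minus its relative interior, and the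
  injective map \<open>h\<close> commutes with this difference.\<close>

lemma homeomorphism_image_rel_frontier:
  fixes S :: "'a::euclidean_space set" and T :: "'b::euclidean_space set"
  assumes h: "homeomorphism S T h k" and dim: "aff_dim S = aff_dim T"
    and "closed S" "closed T"
  shows "h ` rel_frontier S = rel_frontier T"
proof -
  have "inj_on h S"
    by (rule inj_on_inverseI) (rule homeomorphism_apply1[OF h])
  then have "h ` (S - rel_interior S) = h ` S - h ` rel_interior S"
    by (rule inj_on_image_set_diff) (use rel_interior_subset in auto)
  then show ?thesis
    using assms homeomorphism_image_rel_interior[OF h dim] homeomorphism_image1[OF h]
    by (simp add: rel_frontier_def)
qed

text \<open>The relative frontier of the hull of affinely independent points is the union of its
  facets, each the hull of all vertices but one.\<close>

lemma simplex_Bd_eq_rel_frontier: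
  fixes a :: "'i \<Rightarrow> 'a::euclidean_space"
  assumes "finite I" "geometrically_independent I a"
  shows "simplex_Bd I a = rel_frontier (spanned_simplex I a)"
proof -
  have inj: "inj_on a I" and indep: "\<not> affine_dependent (a ` I)"
    using assms geometrically_independent_iff by blast+
  \<comment> \<open>Dropping the index \<open>j\<close> drops the point \<open>a j\<close> because
    no other index yields the same point.\<close>
  have "spanned_simplex (I - {j}) a = convex hull (a ` I - {a j})" if "j \<in> I" for j
  proof -
    have "a ` (I - {j}) = a ` I - {a j}"
      using inj_on_image_set_diff[OF inj, of I "{j}"] that by simp
    then show ?thesis
      using assms inj by (simp add: spanned_simplex_eq_convex_hull inj_on_diff)
  qed
  then have "simplex_Bd I a = (\<Union>x\<in>a ` I. convex hull (a ` I - {x}))"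
    by (simp add: simplex_Bd_def)
  then show ?thesis
    unfolding spanned_simplex_eq_convex_hull[OF assms(1) inj] rel_frontier_convex_hull_cases[OF indep]
    by blast
qed

theorem theorem3p19:
  fixes n :: nat and a :: "nat \<Rightarrow> real ^ 'N"
  assumes "CARD('n::finite) = n"
    and "geometrically_independent {0..n} a"
  shows "\<exists>h k. homeomorphism (spanned_simplex {0..n} a) (cball (0 :: real ^ 'n) 1) h k \<and>
               h ` simplex_Bd {0..n} a = sphere 0 1"
proof -
  let ?S = "spanned_simplex {0..n} a" and ?B = "cball (0 :: real ^ 'n) 1"
  have inj: "inj_on a {0..n}" and indep: "\<not> affine_dependent (a ` {0..n})"
    using assms geometrically_independent_iff by blast+
  have S: "?S = convex hull (a ` {0..n})"
    using inj by (simp add: spanned_simplex_eq_convex_hull)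
  have "compact ?S" "convex ?S"
    by (simp_all add: S finite_imp_compact_convex_hull)
  \<comment> \<open>There are n+1 distinct vertices, so the dimension is n, that of a ball of
    positive radius in \<open>real ^ 'n\<close>.\<close>
  have "aff_dim ?S = int (card (a ` {0..n})) - 1"
    using indep by (simp add: S aff_dim_convex_hull aff_dim_affine_independent)
  also have "\<dots> = aff_dim ?B"
    using assms(1) inj by (simp add: card_image aff_dim_cball)
  finally have dim: "aff_dim ?S = aff_dim ?B" .
  then have "?S homeomorphic ?B"
    using \<open>compact ?S\<close> \<open>convex ?S\<close> by (intro homeomorphic_convex_compact_sets) auto
  then obtain h k where hk: "homeomorphism ?S ?B h k"
    by (auto simp: homeomorphic_def)
  have "simplex_Bd {0..n} a = rel_frontier ?S"
    using assms(2) by (intro simplex_Bd_eq_rel_frontier) auto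
  then have "h ` simplex_Bd {0..n} a = rel_frontier ?B"
    using homeomorphism_image_rel_frontier[OF hk dim] \<open>compact ?S\<close> by (simp add: compact_imp_closed)
  \<comment> \<open>The radius is nonzero, so the relative frontier of the ball is its
    sphere.\<close>
  then have "h ` simplex_Bd {0..n} a = sphere 0 1"
    by simp
  with hk show ?thesis
    by blast
qed

end
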